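(* Let $n\ge 1$ be an integer and let $f:[-1,1]^n\to\mathbb{R}$ be a function that is $1$-Lipschitz with respect to the $\ell^1$ metric and odd. Let $X_1,\dots,X_n$ be independent symmetric real random variables such that $|X_i|\le 1$ for all $i$. Then for every real $x>0$, $$\mathbb{P}\{f(X_1,\dots,X_n)\ge x\}\le \begin{cases}\mathbb{P}\{W_n\ge x\}, & \text{if } n+\lceil x\rceil \text{ is even},\\ \mathbb{P}\{W_{n-1}\ge x\}, & \text{if } n+\lceil x\rceil \text{ is odd}.\end{cases}$$
   Context: The function $f:[-1,1]^n\to\mathbb{R}$ is $1$-Lipschitz with respect to the $\ell^1$ metric if $|f(u)-f(v)|\le \sum_{i=1}^n|u_i-v_i|$ for all $u,v\in[-1,1]^n$, and odd if $f(-u)=-f(u)$ for all $u\in[-1,1]^n$. A random variable $X$ is symmetric if $X$ and $-X$ have the same distribution. For an integer $m\ge 0$, $W_m=\varepsilon_1+\cdots+\varepsilon_m$ denotes a sum of $m$ independent Rademacher random variables, i.e. $\mathbb{P}\{\varepsilon_i=1\}=\mathbb{P}\{\varepsilon_i=-1\}=1/2$; in particular $W_0=0$. $\lceil x\rceil$ is the least integer that is at least $x$. *)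

theory Defs
  imports "HOL-Probability.Probability" "HOL-Probability.Product_PMF"
begin

definition cube :: "(real ^ 'n) set" where
  "cube = {u. \<forall>i. u $ i \<in> {-1..1}}"

definition one_lipschitz_l1 :: "(real ^ 'n \<Rightarrow> real) \<Rightarrow> bool" where
  "one_lipschitz_l1 f \<longleftrightarrow>
     (\<forall>u\<in>cube. \<forall>v\<in>cube. \<bar>f u - f v\<bar> \<le> (\<Sum>i\<in>UNIV. \<bar>u $ i - v $ i\<bar>))"

definition odd_on_cube :: "(real ^ 'n \<Rightarrow> real) \<Rightarrow> bool" where
  "odd_on_cube f \<longleftrightarrow> (\<forall>u\<in>cube. f (- u) = - f u)"

definition symmetric_rv :: "'a measure \<Rightarrow> ('a \<Rightarrow> real) \<Rightarrow> bool" where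
  "symmetric_rv M X \<longleftrightarrow>
     X \<in> borel_measurable M \<and> distr M borel X = distr M borel (\<lambda>\<omega>. - X \<omega>)"

definition rademacher_pmf :: "real pmf" where
  "rademacher_pmf = pmf_of_set {-1, 1}"

(* The distribution of W_m: the m signs are the coordinates of the product distribution.
   The argument 0 of Pi_pmf is only the value of a sign vector outside {..<m}. *)
definition W_pmf :: "nat \<Rightarrow> real pmf" where
  "W_pmf m = map_pmf (\<lambda>\<epsilon>. \<Sum>i<m. \<epsilon> i) (Pi_pmf {..<m} 0 (\<lambda>_. rademacher_pmf))"

end

theory Submission
  imports Defs
begin

text \<open>
  Changing the signs of the coordinates of $X = (X_1, \ldots, X_n)$ does not change its joint
  distribution, because the coordinates are independent and symmetric. Averaging the probability
  of $f(X) \ge x$ over all $2^n$ sign patterns therefore turns it into the expectation of a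
  proportion: for each outcome, the proportion of sign patterns $T$ for which the sign-changed
  vector lies in the set $\{f \ge x\}$. It is enough to bound this proportion for every outcome.

  Fix an outcome and let $F$ be the family of these patterns. If $A, B \in F$, then $f$ is at least
  $x$ at the vector of $A$ and, being odd, at most $-x$ at the negative of the vector of $B$. These
  two points differ only in the coordinates where $A$ and $B$ agree, and there by at most $2$; the
  Lipschitz condition shows that $A$ and $B$ agree in at least $k = \lceil x \rceil \ge 1$
  coordinates (\<open>agreeing_flips\<close>). In other words $F$ is a subset of the discrete cube of diameter
  at most $n - k$, and the claimed bound is Kleitman's diameter theorem (\<open>Kleitman_diameter\<close>),
  with the sizes of the extremal families written as tail probabilities of a simple random walk.

  Kleitman's theorem is proved by induction on the dimension. A reflection of the cube pushes a
  family to one side without changing its size and without destroying the agreement condition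
  (\<open>polarization\<close>). A family on which no such push is possible is closed under enlarging sets, and
  under exchanging any element for a distinguished element $a$ (\<open>compressed_family\<close>). Closure under
  enlarging upgrades agreement to intersection: any two members share at least $k$ elements.
  Now split by membership of $a$. The members containing $a$ still share $k - 1$ elements after $a$
  is deleted. Two members avoiding $a$ share at least $k + 1$, since exchanging a common element of
  one of them for $a$ destroys one common element and leaves at least $k$. This gives the recursion
  of the tails of the random walk, whose boundary case $k = 1$ is the bound by half of the cube.
\<close>

section \<open>Tails of the Rademacher walk\<close>

definition tail :: "nat \<Rightarrow> real \<Rightarrow> real" where
  "tail n x = measure_pmf.prob (W_pmf n) {w. w \<ge> x}"

lemma tail_0: "tail 0 x = (if x \<le> 0 then 1 else 0)"
  by (simp add: tail_def W_pmf_def)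

lemma W_pmf_Suc:
  "W_pmf (Suc n) = rademacher_pmf \<bind> (\<lambda>e. map_pmf (\<lambda>w. w + e) (W_pmf n))"
proof -
  have "W_pmf (Suc n) = map_pmf (\<lambda>(e, g). \<Sum>i<Suc n. (g(n := e)) i)
      (pair_pmf rademacher_pmf (Pi_pmf {..<n} 0 (\<lambda>_. rademacher_pmf)))"
    by (simp add: W_pmf_def lessThan_Suc Pi_pmf_insert pmf.map_comp o_def case_prod_unfold)
  also have "(\<lambda>(e::real, g). \<Sum>i<Suc n. (g(n := e)) i) = (\<lambda>(e, g). (\<Sum>i<n. g i) + e)"
    by (auto simp: fun_eq_iff intro!: sum.cong)
  finally show ?thesis
    by (simp add: W_pmf_def pair_pmf_def map_bind_pmf pmf.map_comp o_def map_pmf_def bind_assoc_pmf bind_return_pmf)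
qed

lemma tail_Suc: "tail (Suc n) x = (tail n (x - 1) + tail n (x + 1)) / 2"
proof -
  have shifted: "pmf (map_pmf (\<lambda>w. x \<le> w + e) (W_pmf n)) True = tail n (x - e)" for e
    by (simp add: tail_def pmf_map vimage_def diff_le_eq)
  have "tail (Suc n) x = pmf (map_pmf (\<lambda>w. x \<le> w) (W_pmf (Suc n))) True"
    by (simp add: tail_def pmf_map vimage_def)
  also have "\<dots> = measure_pmf.expectation rademacher_pmf (\<lambda>e. tail n (x - e))"
    unfolding W_pmf_Suc by (simp add: map_bind_pmf pmf_bind pmf.map_comp o_def shifted)
  also have "\<dots> = (tail n (x - 1) + tail n (x + 1)) / 2"
    by (simp add: rademacher_pmf_def integral_pmf_of_set)
  finally show ?thesis .
qed

text \<open>The walk takes integer values, so only the integer thresholds matter.\<close>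

lemma tail_ceiling: "tail n x = tail n (of_int \<lceil>x\<rceil>)"
proof (induction n arbitrary: x)
  case 0
  then show ?case by (simp add: tail_0)
next
  case (Suc n)
  show ?case
    unfolding tail_Suc Suc.IH[of "x - 1"] Suc.IH[of "x + 1"] by simp
qed

text \<open>
  By symmetry, the second summand is the probability that the walk is at most $k - 1$.
\<close>

lemma tail_complement: "tail n (of_int k) + tail n (of_int (1 - k)) = 1"
proof (induction n arbitrary: k)
  case 0
  then show ?case by (auto simp: tail_0)
next
  case (Suc n)
  from Suc[of "k - 1"] Suc[of "k + 1"] show ?case
    by (simp add: tail_Suc field_simps)
qed

text \<open>After $n$ steps the walk has the parity of $n$ and so misses the value $k$.\<close>

lemma tail_parity: "odd (int n + k) \<Longrightarrow> tail n (of_int k) = tail n (of_int (k + 1))"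
proof (induction n arbitrary: k)
  case 0
  then have "k \<le> 0 \<longleftrightarrow> k + 1 \<le> 0" by simp presburger
  then show ?case unfolding tail_0 of_int_le_0_iff by simp
next
  case (Suc n)
  from Suc.IH[of "k - 1"] Suc.IH[of "k + 1"] Suc.prems show ?case
    by (simp add: tail_Suc algebra_simps)
qed

lemma tail_odd_1: "odd n \<Longrightarrow> tail n 1 = 1 / 2"
  using tail_parity[of n 0] tail_complement[of n 0] by simp

text \<open>
  Multiplied by $2^n$, this is the largest size of a subset of the discrete $n$-cube of diameter at
  most $n - k$, for $1 \le k \le n$: when $n - k$ is even a Hamming ball, and when $n - k$ is odd
  the product of an edge with a Hamming ball in dimension $n - 1$.
\<close>

definition parity_tail :: "nat \<Rightarrow> nat \<Rightarrow> real" where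
  "parity_tail n k = (if even (n + k) then tail n (real k) else tail (n - 1) (real k))"

lemma parity_tail_1: "parity_tail (Suc n) 1 = 1 / 2"
  by (cases "even n") (auto simp: parity_tail_def tail_odd_1)

lemma parity_tail_nonneg: "0 \<le> parity_tail n k"
  by (simp add: parity_tail_def tail_def)

lemma parity_tail_Suc:
  assumes "k \<ge> 2"
  shows "parity_tail (Suc n) k = (parity_tail n (k - 1) + parity_tail n (k + 1)) / 2"
proof (cases n)
  case 0
  \<comment> \<open>The truncated value $n - 1 = 0$ is harmless: every threshold involved is positive.\<close>
  then show ?thesis using assms by (auto simp: parity_tail_def tail_Suc tail_0)
next
  case (Suc m)
  then show ?thesis using assms by (auto simp: parity_tail_def tail_Suc of_nat_diff add_ac)
qed

section \<open>Compression of agreeing families\<close>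

text \<open>
  Two-point symmetrization with respect to an isometric involution \<open>\<sigma>\<close>: a member is moved to
  its mirror image when this increases the weight and the image is not already occupied. The
  heavier side plays the role of the favoured half-space, and the last condition on $c$ says that
  two points on this side agree at least as much as a point and the mirror image of the other.
  Two moved members keep their agreement because \<open>\<sigma>\<close> is an isometry. For one moved member and one
  that stays, either this condition or the occupied mirror image of the other member gives the bound.
\<close>

lemma polarization:
  fixes c :: "'b \<Rightarrow> 'b \<Rightarrow> nat" and w :: "'b \<Rightarrow> nat"
  assumes F: "finite F" "F \<subseteq> U" "\<And>p q. p \<in> F \<Longrightarrow> q \<in> F \<Longrightarrow> k \<le> c p q"
    and refl_in: "\<And>p. p \<in> U \<Longrightarrow> \<sigma> p \<in> U"
    and invol: "\<And>p. p \<in> U \<Longrightarrow> \<sigma> (\<sigma> p) = p"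
    and isom: "\<And>p q. p \<in> U \<Longrightarrow> q \<in> U \<Longrightarrow> c (\<sigma> p) (\<sigma> q) = c p q"
    and comm: "\<And>p q. c p q = c q p"
    and half: "\<And>p q. p \<in> U \<Longrightarrow> q \<in> U \<Longrightarrow> w (\<sigma> p) \<le> w p \<Longrightarrow> w (\<sigma> q) \<le> w q \<Longrightarrow> c p (\<sigma> q) \<le> c p q"
    and move: "p0 \<in> F" "w p0 < w (\<sigma> p0)" "\<sigma> p0 \<notin> F"
  shows "\<exists>F'\<subseteq>U. card F' = card F \<and> (\<forall>p\<in>F'. \<forall>q\<in>F'. k \<le> c p q) \<and> sum w F < sum w F'"
proof -
  define \<tau> where "\<tau> p = (if w p < w (\<sigma> p) \<and> \<sigma> p \<notin> F then \<sigma> p else p)" for p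
  have inj: "inj_on \<tau> F"
    using F(2) invol by (auto simp: inj_on_def \<tau>_def subset_iff) (metis)+
  show ?thesis
  proof (intro exI[of _ "\<tau> ` F"] conjI ballI)
    show "\<tau> ` F \<subseteq> U"
      using F(2) refl_in by (auto simp: \<tau>_def)
    show "card (\<tau> ` F) = card F"
      using inj by (rule card_image)
    \<comment> \<open>\<open>p\<close> stays in place, either because it is on the heavier side or because its image is occupied.\<close>
    have mixed: "k \<le> c p (\<sigma> q)"
      if "p \<in> F" "w p < w (\<sigma> p) \<Longrightarrow> \<sigma> p \<in> F" "q \<in> F" "w q < w (\<sigma> q)" for p q
    proof (cases "w p < w (\<sigma> p)")
      case True
      then have "k \<le> c (\<sigma> p) q" using that F(3) by blast
      also have "\<dots> = c p (\<sigma> q)"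
        using isom[of p "\<sigma> q"] that F(2) invol refl_in by (auto simp: subset_iff)
      finally show ?thesis .
    next
      case False
      have "k \<le> c p q" using that F(3) by blast
      also have "\<dots> \<le> c p (\<sigma> q)"
        using half[of p "\<sigma> q"] False that F(2) invol refl_in by (auto simp: subset_iff)
      finally show ?thesis .
    qed
    have both: "k \<le> c (\<sigma> p) (\<sigma> q)" if "p \<in> F" "q \<in> F" for p q
      using that F isom by (auto simp: subset_iff)
    show "k \<le> c p q" if "p \<in> \<tau> ` F" "q \<in> \<tau> ` F" for p q
    proof -
      obtain p' q' where pq: "p = \<tau> p'" "q = \<tau> q'" "p' \<in> F" "q' \<in> F"
        using \<open>p \<in> \<tau> ` F\<close> \<open>q \<in> \<tau> ` F\<close> by blast
      show ?thesis
        using mixed[of p' q'] mixed[of q' p'] both[of p' q'] F(3)[of p' q'] pq comm[of p' "\<sigma> q'"]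
          comm[of q' "\<sigma> p'"]
        unfolding \<tau>_def by (auto split: if_splits)
    qed
    have "sum w F < sum (w \<circ> \<tau>) F"
      using move by (intro sum_strict_mono_ex1 F) (auto simp: \<tau>_def)
    also have "\<dots> = sum w (\<tau> ` F)"
      by (rule sum.reindex[OF inj, symmetric])
    finally show "sum w F < sum w (\<tau> ` F)" .
  qed
qed

definition agreement :: "'b set \<Rightarrow> 'b set \<Rightarrow> 'b set \<Rightarrow> nat" where
  "agreement S A B = card {i \<in> S. i \<in> A \<longleftrightarrow> i \<in> B}"

definition agreeing :: "'b set \<Rightarrow> nat \<Rightarrow> 'b set set \<Rightarrow> bool" where
  "agreeing S k F \<longleftrightarrow> F \<subseteq> Pow S \<and> (\<forall>A\<in>F. \<forall>B\<in>F. k \<le> agreement S A B)"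

lemma agreement_commute: "agreement S A B = agreement S B A"
  unfolding agreement_def by (rule arg_cong[where f = card]) auto

definition toggle :: "'b \<Rightarrow> 'b set \<Rightarrow> 'b set" where
  "toggle i A = (if i \<in> A then A - {i} else insert i A)"

lemma toggle_toggle: "toggle i (toggle i A) = A"
  by (auto simp: toggle_def)

lemma agreement_toggle: "agreement S (toggle i A) (toggle i B) = agreement S A B"
  unfolding agreement_def toggle_def by (rule arg_cong[where f = card]) auto

text \<open>The favoured half-space of a toggle consists of the sets that contain the element.\<close>

lemma agreement_toggle_le:
  assumes "finite S" "i \<in> A" "i \<in> B"
  shows "agreement S A (toggle i B) \<le> agreement S A B"
  unfolding agreement_def using assms by (intro card_mono) (auto simp: toggle_def split: if_splits)

definition swap :: "'b \<Rightarrow> 'b \<Rightarrow> 'b set \<Rightarrow> 'b set" where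
  "swap x y A = Transposition.transpose x y ` A"

lemma in_swap: "z \<in> swap x y A \<longleftrightarrow> Transposition.transpose x y z \<in> A"
  unfolding swap_def by (metis image_iff transpose_involutory)

lemma swap_swap: "swap x y (swap x y A) = A"
  by (auto simp: in_swap)

lemma swap_fixed: "(x \<in> A \<longleftrightarrow> y \<in> A) \<Longrightarrow> swap x y A = A"
  by (auto simp: in_swap Transposition.transpose_def split: if_splits)

lemma swap_moved: "x \<in> A \<Longrightarrow> y \<notin> A \<Longrightarrow> swap x y A = insert y (A - {x})"
  by (auto simp: in_swap Transposition.transpose_def split: if_splits)

lemma swap_moved': "x \<notin> A \<Longrightarrow> y \<in> A \<Longrightarrow> swap x y A = insert x (A - {y})"
  by (auto simp: in_swap Transposition.transpose_def split: if_splits)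

lemma agreement_swap:
  assumes "x \<in> S" "y \<in> S"
  shows "agreement S (swap x y A) (swap x y B) = agreement S A B"
proof -
  have "{i \<in> S. i \<in> swap x y A \<longleftrightarrow> i \<in> swap x y B} = Transposition.transpose x y ` {i \<in> S. i \<in> A \<longleftrightarrow> i \<in> B}"
    using assms by (auto simp: in_swap swap_def[symmetric] Transposition.transpose_def split: if_splits)
  then show ?thesis
    unfolding agreement_def by (simp add: card_image)
qed

text \<open>
  The favoured side of a swap consists of the sets that do not contain \<open>x\<close> without \<open>y\<close>. For two
  such sets the only case in which swapping one of them changes the agreement is that both contain
  \<open>y\<close> but not \<open>x\<close>; then the agreement at both points is lost.
\<close>

lemma agreement_swap_le:
  assumes "finite S" "x \<in> S" "y \<in> S" "x \<in> A \<Longrightarrow> y \<in> A" "x \<in> B \<Longrightarrow> y \<in> B"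
  shows "agreement S A (swap x y B) \<le> agreement S A B"
proof -
  consider "x \<in> A \<longleftrightarrow> y \<in> A" | "x \<in> B \<longleftrightarrow> y \<in> B" | "y \<in> A" "x \<notin> A" "y \<in> B" "x \<notin> B"
    using assms by blast
  then show ?thesis
  proof cases
    case 1
    then show ?thesis using agreement_swap[OF assms(2,3), of A B] by (simp add: swap_fixed)
  next
    case 2
    then show ?thesis by (simp add: swap_fixed)
  next
    case 3
    then show ?thesis
      unfolding agreement_def swap_moved'[OF 3(4,3)] using assms(1) by (intro card_mono) auto
  qed
qed

text \<open>
  Among the families of the same size that satisfy the agreement condition, one of maximal total
  weight admits no further polarization. Toggling an element into a set raises its weight through
  the cardinality, and exchanging an element for \<open>a\<close> raises it through the bonus for containing
  \<open>a\<close>, so both closure properties follow from this single maximality.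
\<close>

lemma compressed_family:
  assumes S: "finite S" "a \<in> S" and F: "agreeing S k F"
  obtains G where "agreeing S k G" "card G = card F"
    "\<And>i A. A \<in> G \<Longrightarrow> i \<in> S \<Longrightarrow> insert i A \<in> G"
    "\<And>x A. A \<in> G \<Longrightarrow> x \<in> A \<Longrightarrow> a \<notin> A \<Longrightarrow> insert a (A - {x}) \<in> G"
proof -
  define w where "w A = card A + of_bool (a \<in> A)" for A
  define P where "P G \<longleftrightarrow> agreeing S k G \<and> card G = card F" for G
  have bound: "sum w G \<le> sum w (Pow S)" if "P G" for G
    using that S by (intro sum_mono2) (auto simp: P_def agreeing_def)
  obtain G where G: "P G" and max: "\<And>G'. P G' \<Longrightarrow> sum w G' \<le> sum w G"
  proof -
    have "P F" using F by (simp add: P_def)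
    then have "\<exists>G. P G \<and> (\<forall>G'. P G' \<longrightarrow> sum w G' \<le> sum w G)"
      using bound by (intro ex_has_greatest_nat[of P F "sum w" "Suc (sum w (Pow S))"]) (auto simp: less_Suc_eq_le)
    then show ?thesis using that by blast
  qed
  have GS: "G \<subseteq> Pow S" and finG: "finite G"
    using G S by (auto simp: P_def agreeing_def intro: finite_subset)
  have compressed: "\<sigma> A \<in> G"
    if refl: "\<And>p. p \<in> Pow S \<Longrightarrow> \<sigma> p \<in> Pow S" "\<And>p. p \<in> Pow S \<Longrightarrow> \<sigma> (\<sigma> p) = p"
      and isom: "\<And>p q. p \<in> Pow S \<Longrightarrow> q \<in> Pow S \<Longrightarrow> agreement S (\<sigma> p) (\<sigma> q) = agreement S p q"
      and half: "\<And>p q. p \<in> Pow S \<Longrightarrow> q \<in> Pow S \<Longrightarrow> w (\<sigma> p) \<le> w p \<Longrightarrow> w (\<sigma> q) \<le> w q \<Longrightarrow>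
        agreement S p (\<sigma> q) \<le> agreement S p q"
      and A: "A \<in> G" "w A < w (\<sigma> A)" for \<sigma> A
  proof (rule ccontr)
    assume "\<sigma> A \<notin> G"
    have "\<exists>G'\<subseteq>Pow S. card G' = card G \<and> (\<forall>p\<in>G'. \<forall>q\<in>G'. k \<le> agreement S p q) \<and>
      sum w G < sum w G'"
    proof (rule polarization[of G "Pow S" k "agreement S" \<sigma> w A])
      show "k \<le> agreement S p q" if "p \<in> G" "q \<in> G" for p q
        using G that by (auto simp: P_def agreeing_def)
    qed (fact finG GS refl isom agreement_commute half A \<open>\<sigma> A \<notin> G\<close>)+
    then obtain G' where "P G'" "sum w G < sum w G'"
      using G by (auto simp: P_def agreeing_def)
    with max[of G'] show False by simp
  qed
  have fin: "finite p" if "p \<in> Pow S" for p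
    using that S by (auto intro: finite_subset)
  have card_swap: "card (swap x y p) = card p" for x y :: 'b and p
    unfolding swap_def by (simp add: card_image)
  show ?thesis
  proof (rule that[of G])
    show "agreeing S k G" "card G = card F"
      using G by (auto simp: P_def)
    show "insert i A \<in> G" if "A \<in> G" "i \<in> S" for i A
    proof (cases "i \<in> A")
      case True
      then show ?thesis using that by (simp add: insert_absorb)
    next
      case False
      have w_toggle: "w (toggle i p) \<le> w p \<longleftrightarrow> i \<in> p" if "p \<in> Pow S" for p
        using fin[OF that] by (auto simp: w_def toggle_def card_Diff_singleton card_gt_0_iff split: if_splits)
      have "toggle i A \<in> G"
      proof (rule compressed[of "toggle i" A])
        show "toggle i p \<in> Pow S" if "p \<in> Pow S" for p
          using that \<open>i \<in> S\<close> by (auto simp: toggle_def)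
        show "agreement S p (toggle i q) \<le> agreement S p q"
          if "p \<in> Pow S" "q \<in> Pow S" "w (toggle i p) \<le> w p" "w (toggle i q) \<le> w q" for p q
          using that w_toggle S(1) by (intro agreement_toggle_le) simp_all
        show "w A < w (toggle i A)"
          using w_toggle[of A] False GS \<open>A \<in> G\<close> by auto
      qed (simp_all only: toggle_toggle agreement_toggle \<open>A \<in> G\<close>)
      then show ?thesis using False by (simp add: toggle_def)
    qed
    show "insert a (A - {x}) \<in> G" if "A \<in> G" "x \<in> A" "a \<notin> A" for x A
    proof -
      have x: "x \<in> S" using that GS by auto
      have w_swap: "w (swap x a p) \<le> w p \<longleftrightarrow> (x \<in> p \<longrightarrow> a \<in> p)" if "p \<in> Pow S" for p
        by (auto simp: w_def card_swap in_swap)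
      have "swap x a A \<in> G"
      proof (rule compressed[of "swap x a" A])
        show "swap x a p \<in> Pow S" if "p \<in> Pow S" for p
          using that x \<open>a \<in> S\<close> by (auto simp: swap_def Transposition.transpose_def)
        show "agreement S (swap x a p) (swap x a q) = agreement S p q" for p q
          using x S by (simp add: agreement_swap)
        show "agreement S p (swap x a q) \<le> agreement S p q"
          if "p \<in> Pow S" "q \<in> Pow S" "w (swap x a p) \<le> w p" "w (swap x a q) \<le> w q" for p q
          using that(3,4) w_swap[OF that(1)] w_swap[OF that(2)] S x by (intro agreement_swap_le) simp_all
        show "w A < w (swap x a A)"
          using that by (simp add: w_def card_swap in_swap)
      qed (simp_all only: swap_swap \<open>A \<in> G\<close>)
      then show ?thesis using that by (simp add: swap_moved)
    qed
  qed
qed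

section \<open>The diameter theorem\<close>

text \<open>
  Enlarging \<open>B\<close> by the complement of \<open>A\<close> removes all agreement with \<open>A\<close> outside of \<open>A\<close>, so that
  only the common elements remain.
\<close>

lemma agreeing_up_closed_Int:
  assumes "finite S" and G: "agreeing S k G" and up: "\<And>i A. A \<in> G \<Longrightarrow> i \<in> S \<Longrightarrow> insert i A \<in> G"
    and AB: "A \<in> G" "B \<in> G"
  shows "k \<le> card (A \<inter> B)"
proof -
  have union: "B \<union> D \<in> G" if "D \<subseteq> S" for D
    using finite_subset[OF that \<open>finite S\<close>] that
  proof (induction D rule: finite_induct)
    case empty
    then show ?case using AB by simp
  next
    case (insert i D)
    then show ?case using up[of "B \<union> D" i] by simp
  qed
  have "B \<union> (S - A) \<in> G" by (rule union) simp
  then have "k \<le> agreement S A (B \<union> (S - A))"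
    using G AB(1) by (simp add: agreeing_def)
  also have "agreement S A (B \<union> (S - A)) = card (A \<inter> B)"
  proof -
    have "A \<subseteq> S" using G AB(1) by (auto simp: agreeing_def)
    then have "{i \<in> S. i \<in> A \<longleftrightarrow> i \<in> B \<union> (S - A)} = A \<inter> B" by blast
    then show ?thesis by (simp only: agreement_def)
  qed
  finally show ?thesis .
qed

text \<open>The family contains no set together with its complement.\<close>

lemma card_agreeing_1:
  assumes "finite S" "agreeing S 1 F"
  shows "2 * card F \<le> 2 ^ card S"
proof -
  let ?F' = "(\<lambda>A. S - A) ` F"
  have FS: "F \<subseteq> Pow S" and fin: "finite F"
    using assms by (auto simp: agreeing_def intro: finite_subset)
  have inj: "inj_on (\<lambda>A. S - A) F"
    using FS by (auto simp: inj_on_def)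
  have "{i \<in> S. i \<in> A \<longleftrightarrow> i \<in> S - A} = {}" for A
    by blast
  then have "agreement S A (S - A) = 0" for A
    by (simp only: agreement_def card.empty)
  then have "S - A \<notin> F" if "A \<in> F" for A
    using assms(2) that unfolding agreeing_def by (metis not_one_le_zero)
  then have "F \<inter> ?F' = {}" by blast
  then have "2 * card F = card (F \<union> ?F')"
    using fin inj by (simp add: card_Un_disjoint card_image)
  also have "\<dots> \<le> card (Pow S)"
    using FS assms by (intro card_mono) auto
  finally show ?thesis using assms by (simp add: card_Pow)
qed

text \<open>
  Kleitman's bound on the size of a subset of the discrete cube of given diameter; agreement in at
  least $k$ coordinates means Hamming distance at most $n - k$. The case $k = 1$ is separate
  because the recursion would need the bound for $k = 0$, where no condition is left.
\<close>

theorem Kleitman_diameter: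
  assumes "finite S" "k \<ge> 1" "agreeing S k F"
  shows "real (card F) \<le> 2 ^ card S * parity_tail (card S) k"
  using assms
proof (induction S arbitrary: k F rule: finite_induct)
  case empty
  have "F = {}"
    using empty by (auto simp: agreeing_def agreement_def)
  then show ?case by (simp add: parity_tail_nonneg)
next
  case (insert a S)
  show ?case
  proof (cases "k = 1")
    case True
    then have "2 * card F \<le> 2 ^ card (insert a S)"
      using insert.prems(2) insert.hyps(1) by (intro card_agreeing_1) simp_all
    then have "card F \<le> 2 ^ card S"
      by (simp add: card_insert_disjoint[OF insert.hyps])
    then have "real (card F) \<le> 2 ^ card S"
      using of_nat_le_iff[of "card F" "2 ^ card S", where 'a = real] by simp
    then show ?thesis
      by (simp only: True card_insert_disjoint[OF insert.hyps] parity_tail_1) simp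
  next
    case False
    obtain G where G: "agreeing (insert a S) k G" "card G = card F"
      and up: "\<And>i A. A \<in> G \<Longrightarrow> i \<in> insert a S \<Longrightarrow> insert i A \<in> G"
      and shift: "\<And>x A. A \<in> G \<Longrightarrow> x \<in> A \<Longrightarrow> a \<notin> A \<Longrightarrow> insert a (A - {x}) \<in> G"
      
      by (rule compressed_family[OF _ _ insert.prems(2), of a]) (use insert.hyps(1) in auto)
    have int: "k \<le> card (A \<inter> B)" if "A \<in> G" "B \<in> G" for A B
      by (rule agreeing_up_closed_Int[OF _ G(1) up that]) (use insert.hyps(1) in auto)
    have GS: "A \<subseteq> insert a S" if "A \<in> G" for A
      using G(1) that by (auto simp: agreeing_def)
    have fin: "finite G"
      by (rule finite_subset[of _ "Pow (insert a S)"]) (use GS insert.hyps(1) in auto)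
    have finA: "finite A" if "A \<in> G" for A
      by (rule finite_subset[OF GS[OF that]]) (use insert.hyps(1) in simp)
    have int_agree: "card (A \<inter> B) \<le> agreement S A B" if "A \<subseteq> S" for A B
      unfolding agreement_def using that insert.hyps by (intro card_mono) auto
    define G0 where "G0 = {A \<in> G. a \<notin> A}"
    define G1 where "G1 = (\<lambda>A. A - {a}) ` {A \<in> G. a \<in> A}"
    have "agreeing S (k + 1) G0"
      unfolding agreeing_def
    proof (intro conjI ballI)
      show "G0 \<subseteq> Pow S" using GS by (auto simp: G0_def)
      fix A B assume A: "A \<in> G0" and B: "B \<in> G0"
      then have AB: "A \<in> G" "B \<in> G" "a \<notin> A" "a \<notin> B" "A \<subseteq> S"
        using GS by (auto simp: G0_def)
      have "A \<inter> B \<noteq> {}"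
        using int[OF AB(1,2)] insert.prems by auto
      then obtain x where x: "x \<in> A" "x \<in> B" by blast
      \<comment> \<open>The exchanged set is again a member, yet it has lost \<open>x\<close> from the intersection with \<open>B\<close>.\<close>
      have "k \<le> card (insert a (A - {x}) \<inter> B)"
        using shift x AB by (intro int) auto
      also have "insert a (A - {x}) \<inter> B = (A \<inter> B) - {x}"
        using AB by auto
      also have "card \<dots> < card (A \<inter> B)"
        using x finA[OF AB(1)] by (intro psubset_card_mono) auto
      also have "\<dots> \<le> agreement S A B"
        using AB by (intro int_agree)
      finally show "k + 1 \<le> agreement S A B" by simp
    qed
    then have G0: "real (card G0) \<le> 2 ^ card S * parity_tail (card S) (k + 1)"
      by (intro insert.IH) simp_all
    have "agreeing S (k - 1) G1"
      unfolding agreeing_def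
    proof (intro conjI ballI)
      show "G1 \<subseteq> Pow S" using GS by (auto simp: G1_def)
      fix A' B' assume "A' \<in> G1" "B' \<in> G1"
      then obtain A B where AB: "A \<in> G" "B \<in> G" "a \<in> A" "a \<in> B" "A' = A - {a}" "B' = B - {a}"
        by (auto simp: G1_def)
      have "A' \<inter> B' = (A \<inter> B) - {a}" using AB by auto
      then have "k - 1 \<le> card (A' \<inter> B')"
        using int[OF AB(1,2)] AB finA[OF AB(1)] by (simp add: card_Diff_singleton)
      also have "\<dots> \<le> agreement S A' B'"
        using GS[OF AB(1)] AB by (intro int_agree) auto
      finally show "k - 1 \<le> agreement S A' B'" .
    qed
    then have G1: "real (card G1) \<le> 2 ^ card S * parity_tail (card S) (k - 1)"
      using insert.prems(1) False by (intro insert.IH) simp_all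
    have "card G1 = card {A \<in> G. a \<in> A}"
      unfolding G1_def by (rule card_image) (auto simp: inj_on_def)
    moreover have "card G = card G0 + card {A \<in> G. a \<in> A}"
      unfolding G0_def using fin by (subst card_Un_disjoint[symmetric]) (auto intro: arg_cong[where f = card])
    ultimately have "real (card F) = real (card G0) + real (card G1)"
      using G by simp
    also have "\<dots> \<le> 2 ^ card (insert a S) * parity_tail (card (insert a S)) k"
      using G0 G1 insert.prems(1) False
      by (simp add: card_insert_disjoint[OF insert.hyps] parity_tail_Suc field_simps)
    finally show ?thesis .
  qed
qed

section \<open>Sign changes of a symmetric random vector\<close>

definition flip :: "'n set \<Rightarrow> real ^ 'n \<Rightarrow> real ^ 'n" where
  "flip T u = (\<chi> i. if i \<in> T then u $ i else - u $ i)"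

lemma flip_in_cube: "u \<in> cube \<Longrightarrow> flip T u \<in> cube"
  by (auto simp: cube_def flip_def)

lemma uminus_in_cube: "u \<in> cube \<Longrightarrow> - u \<in> cube"
  using flip_in_cube[of u "{}"] by (simp add: flip_def uminus_vec_def)

text \<open>
  Oddness turns the lower bound at the vector of \<open>B\<close> into an upper bound at its negative, which
  differs from the vector of \<open>A\<close> only in coordinates where \<open>A\<close> and \<open>B\<close> agree.
\<close>

lemma agreeing_flips:
  fixes f :: "real ^ 'n \<Rightarrow> real"
  assumes f: "one_lipschitz_l1 f" "odd_on_cube f" and u: "u \<in> cube"
  shows "agreeing UNIV (nat \<lceil>x\<rceil>) {T. x \<le> f (flip T u)}"
  unfolding agreeing_def
proof (intro conjI ballI)
  fix A B assume "A \<in> {T. x \<le> f (flip T u)}" "B \<in> {T. x \<le> f (flip T u)}"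
  then have AB: "x \<le> f (flip A u)" "x \<le> f (flip B u)" by auto
  have "2 * x \<le> f (flip A u) - f (- flip B u)"
    using AB f(2) flip_in_cube[OF u] by (simp add: odd_on_cube_def)
  also have "\<dots> \<le> (\<Sum>i\<in>UNIV. \<bar>flip A u $ i - (- flip B u) $ i\<bar>)"
    by (rule order_trans[OF abs_ge_self])
      (intro f(1)[unfolded one_lipschitz_l1_def, rule_format] flip_in_cube uminus_in_cube u)
  also have "\<dots> \<le> (\<Sum>i\<in>UNIV. if i \<in> A \<longleftrightarrow> i \<in> B then 2 else 0)"
  proof (rule sum_mono)
    fix i
    have "\<bar>u $ i\<bar> \<le> 1" using u by (auto simp: cube_def abs_le_iff)
    then show "\<bar>flip A u $ i - (- flip B u) $ i\<bar> \<le> (if i \<in> A \<longleftrightarrow> i \<in> B then 2 else 0)"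
      by (auto simp: flip_def)
  qed
  also have "\<dots> = 2 * real (agreement UNIV A B)"
    by (simp add: agreement_def sum.If_cases Collect_conj_eq[symmetric])
  finally show "nat \<lceil>x\<rceil> \<le> agreement UNIV A B"
    by (simp add: nat_le_iff ceiling_le_iff)
qed auto

lemma measurable_vec_lambda:
  fixes Z :: "'n::finite \<Rightarrow> 'a \<Rightarrow> real"
  assumes "\<And>i. Z i \<in> borel_measurable N"
  shows "(\<lambda>\<omega>. \<chi> i. Z i \<omega>) \<in> borel_measurable N"
proof (rule borel_measurable_euclidean_space[THEN iffD2], rule ballI)
  fix b :: "real ^ 'n" assume "b \<in> Basis"
  then obtain i where "b = axis i 1" by (auto simp: Basis_vec_def)
  then show "(\<lambda>\<omega>. (\<chi> i. Z i \<omega>) \<bullet> b) \<in> borel_measurable N"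
    using assms[of i] by (simp add: inner_axis)
qed

text \<open>
  For independent coordinates the joint distribution is the product of the marginal distributions,
  and by symmetry a sign change preserves each of them.
\<close>

lemma distr_flip:
  fixes X :: "'n::finite \<Rightarrow> 'a \<Rightarrow> real"
  assumes "prob_space M" and ind: "prob_space.indep_vars M (\<lambda>_. borel) X UNIV"
    and sym: "\<And>i. symmetric_rv M (X i)"
  shows "distr M borel (\<lambda>\<omega>. flip T (\<chi> i. X i \<omega>)) = distr M borel (\<lambda>\<omega>. \<chi> i. X i \<omega>)"
proof -
  interpret prob_space M by fact
  define Y where "Y i \<omega> = (if i \<in> T then X i \<omega> else - X i \<omega>)" for i \<omega>
  have X_meas[measurable]: "X i \<in> borel_measurable M" for i
    using sym by (simp add: symmetric_rv_def)
  have Y_meas[measurable]: "Y i \<in> borel_measurable M" for i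
    unfolding Y_def by (cases "i \<in> T") simp_all
  have Y_ind: "indep_vars (\<lambda>_. borel) Y UNIV"
    using indep_vars_compose2[OF ind, of "\<lambda>i y. if i \<in> T then y else - y" "\<lambda>_. borel"]
    by (simp add: Y_def[abs_def])
  have Y_distr: "distr M borel (Y i) = distr M borel (X i)" for i
    using sym[of i] by (cases "i \<in> T") (simp_all add: Y_def[abs_def] symmetric_rv_def)
  have vec_meas: "(\<lambda>y. \<chi> i. y i) \<in> (\<Pi>\<^sub>M i\<in>UNIV. borel :: real measure) \<rightarrow>\<^sub>M (borel :: (real ^ 'n) measure)"
    by (rule measurable_vec_lambda) simp
  have vec: "distr M borel (\<lambda>\<omega>. \<chi> i. Z i \<omega>) =
      distr (\<Pi>\<^sub>M i\<in>UNIV. distr M borel (Z i)) borel (\<lambda>y. \<chi> i. y i)"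
    if Z: "indep_vars (\<lambda>_. borel) Z UNIV" "\<And>i. Z i \<in> borel_measurable M" for Z :: "'n \<Rightarrow> 'a \<Rightarrow> real"
  proof -
    have "(\<Pi>\<^sub>M i\<in>UNIV. distr M borel (Z i)) = distr M (\<Pi>\<^sub>M i\<in>UNIV. borel) (\<lambda>\<omega>. \<lambda>i\<in>UNIV. Z i \<omega>)"
      using indep_vars_iff_distr_eq_PiM[of UNIV Z "\<lambda>_. borel"] Z by simp
    then show ?thesis
      using vec_meas Z(2) by (simp add: distr_distr o_def restrict_UNIV measurable_PiM_single' cong: measurable_cong)
  qed
  have "(\<lambda>\<omega>. flip T (\<chi> i. X i \<omega>)) = (\<lambda>\<omega>. \<chi> i. Y i \<omega>)"
    by (auto simp: flip_def Y_def vec_eq_iff fun_eq_iff)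
  then show ?thesis
    using vec[OF Y_ind Y_meas] vec[OF ind X_meas] Y_distr by simp
qed

lemma closed_superlevel:
  fixes f :: "real ^ 'n \<Rightarrow> real"
  assumes "one_lipschitz_l1 f"
  shows "closed {u \<in> cube. x \<le> f u}"
proof -
  have cl: "closed (cube :: (real ^ 'n) set)"
    unfolding cube_def atLeastAtMost_iff Collect_all_eq Collect_conj_eq
    by (intro closed_INT ballI closed_Int closed_Collect_le continuous_intros)
  have "(real CARD('n))-lipschitz_on cube f"
  proof (rule lipschitz_onI)
    fix u v :: "real ^ 'n" assume "u \<in> cube" "v \<in> cube"
    then have "dist (f u) (f v) \<le> (\<Sum>i\<in>UNIV. \<bar>u $ i - v $ i\<bar>)"
      using assms by (simp add: one_lipschitz_l1_def dist_real_def)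
    also have "\<dots> \<le> (\<Sum>i\<in>(UNIV :: 'n set). dist u v)"
      by (intro sum_mono) (metis component_le_norm_cart dist_norm vector_minus_component)
    finally show "dist (f u) (f v) \<le> real CARD('n) * dist u v" by simp
  qed simp
  then have "continuous_on cube f" by (rule lipschitz_on_continuous_on)
  from continuous_closed_preimage[OF this cl, of "{x..}"] show ?thesis
    by (simp add: vimage_def Int_def)
qed

section \<open>The tail bound\<close>

theorem theorem4p2:
  fixes M :: "'a measure"
    and f :: "real ^ 'n \<Rightarrow> real"
    and X :: "'n \<Rightarrow> 'a \<Rightarrow> real"
    and x :: real
  assumes "prob_space M"
    and "one_lipschitz_l1 f"
    and "odd_on_cube f"
    and "prob_space.indep_vars M (\<lambda>_. borel) X UNIV"
    and "\<And>i. symmetric_rv M (X i)"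
    and "\<And>i \<omega>. \<omega> \<in> space M \<Longrightarrow> \<bar>X i \<omega>\<bar> \<le> 1"
    and "x > 0"
  shows "measure M {\<omega> \<in> space M. f (\<chi> i. X i \<omega>) \<ge> x} \<le>
    (if even (int CARD('n) + \<lceil>x\<rceil>)
     then measure_pmf.prob (W_pmf CARD('n)) {w. w \<ge> x}
     else measure_pmf.prob (W_pmf (CARD('n) - 1)) {w. w \<ge> x})"
proof -
  interpret prob_space M by fact
  let ?n = "CARD('n)" and ?k = "nat \<lceil>x\<rceil>"
  let ?V = "\<lambda>\<omega>. \<chi> i. X i \<omega>" and ?C = "{u \<in> cube. x \<le> f u}"
  define E where "E T = {\<omega> \<in> space M. x \<le> f (flip T (?V \<omega>))}" for T
  have V: "?V \<omega> \<in> cube" if "\<omega> \<in> space M" for \<omega>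
    using assms(6)[OF that] by (auto simp: cube_def abs_le_iff)
  have X_meas[measurable]: "X i \<in> borel_measurable M" for i
    using assms(5) by (simp add: symmetric_rv_def)
  have flip_meas[measurable]: "(\<lambda>\<omega>. flip T (?V \<omega>)) \<in> borel_measurable M" for T
    unfolding flip_def vec_lambda_beta by (rule measurable_vec_lambda) simp
  have V_meas[measurable]: "?V \<in> borel_measurable M"
    by (rule measurable_vec_lambda) simp
  have C: "?C \<in> sets borel"
    using closed_superlevel[OF assms(2)] by (rule borel_closed)
  have E_preimage: "E T = (\<lambda>\<omega>. flip T (?V \<omega>)) -` ?C \<inter> space M" for T
    using V flip_in_cube by (auto simp: E_def)
  have E_sets: "E T \<in> sets M" for T
    unfolding E_preimage using C by (intro measurable_sets[OF flip_meas])
  have E_prob: "prob (E T) = prob {\<omega> \<in> space M. x \<le> f (?V \<omega>)}" for T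
  proof -
    have "prob (E T) = measure (distr M borel (\<lambda>\<omega>. flip T (?V \<omega>))) ?C"
      unfolding E_preimage using C by (intro measure_distr[symmetric] flip_meas)
    also have "\<dots> = measure (distr M borel ?V) ?C"
      using distr_flip[OF assms(1,4,5)] by simp
    also have "\<dots> = prob (?V -` ?C \<inter> space M)"
      using C by (intro measure_distr V_meas)
    also have "?V -` ?C \<inter> space M = {\<omega> \<in> space M. x \<le> f (?V \<omega>)}"
      using V by auto
    finally show ?thesis .
  qed
  have k: "1 \<le> ?k"
  proof -
    have "0 < \<lceil>x\<rceil>" using assms(7) by simp
    then show ?thesis by linarith
  qed
  have pointwise: "(\<Sum>T\<in>UNIV. indicator (E T) \<omega>) \<le> 2 ^ ?n * parity_tail ?n ?k" if "\<omega> \<in> space M" for \<omega>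
  proof -
    have "(\<Sum>T\<in>UNIV. indicator (E T) \<omega> :: real) = real (card {T. x \<le> f (flip T (?V \<omega>))})"
      using that by (simp add: E_def indicator_def of_bool_def sum.If_cases)
    also have "\<dots> \<le> 2 ^ ?n * parity_tail ?n ?k"
      using assms(2,3) k V[OF that] by (intro Kleitman_diameter agreeing_flips) auto
    finally show ?thesis .
  qed
  have "2 ^ ?n * prob {\<omega> \<in> space M. x \<le> f (?V \<omega>)} = (\<Sum>T\<in>(UNIV :: 'n set set). prob (E T))"
    by (simp add: E_prob card_UNIV_set)
  also have "\<dots> = expectation (\<lambda>\<omega>. \<Sum>T\<in>UNIV. indicator (E T) \<omega>)"
    using E_sets by (subst Bochner_Integration.integral_sum) (auto simp: emeasure_eq_measure)
  also have "\<dots> \<le> 2 ^ ?n * parity_tail ?n ?k"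
    using E_sets pointwise by (intro integral_le_const) (auto simp: emeasure_eq_measure)
  finally have "prob {\<omega> \<in> space M. x \<le> f (?V \<omega>)} \<le> parity_tail ?n ?k"
    by simp
  also have "parity_tail ?n ?k = (if even (int ?n + \<lceil>x\<rceil>) then tail ?n x else tail (?n - 1) x)"
  proof -
    have "int ?k = \<lceil>x\<rceil>" using assms(7) by simp
    then have "even (?n + ?k) \<longleftrightarrow> even (int ?n + \<lceil>x\<rceil>)"
      by (metis even_of_nat_iff of_nat_add)
    moreover have "real ?k = of_int \<lceil>x\<rceil>"
      using assms(7) by simp
    ultimately show ?thesis
      unfolding parity_tail_def using tail_ceiling[of _ x] by simp
  qed
  finally show ?thesis
    unfolding tail_def .
qed

end
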